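(* Let $K\subset\mathbb{C}$ be a compact convex set having width $w>0$ and diameter $d$. Let $0<q\le\infty$, and let $n$ be a positive integer with $n\ge 2\left(1+\frac1q\right)\frac{d^2}{w^2}\ln\frac{d}{w}$ (where $1/q:=0$ for $q=\infty$). If $\lambda$ is the two-dimensional Lebesgue measure (area) restricted to $K$, then $$M_{n,q}(K,\lambda)\le C_q^*\,\frac{w}{d^2}\,n,$$ where $$C_q^*:=121\,\frac{5q+4+2\sqrt{4q^2+10q+4}}{9q}\left(4q+5+2\sqrt{4q^2+10q+4}\right)^{1/q}$$ for $0<q<\infty$, and $C_\infty^*:=\lim_{q\to\infty}C_q^*=121$.
   Context: For a compact set $K\subset\mathbb{C}$: the diameter is $d=d(K):=\max_{z,z'\in K}|z-z'|$, and the width is $w=w(K):=\min_{\gamma\in[-\pi,\pi]}\max_{z,z'\in K}\left(\operatorname{Re}(ze^{i\gamma})-\operatorname{Re}(z'e^{i\gamma})\right)$. For a finite Borel measure $\mu$ on $K$ and a polynomial $p\in\mathbb{C}[z]$: $\|p\|_q:=\left(\int_K|p(z)|^q\,\mu(dz)\right)^{1/q}$ for $0<q<\infty$, and $\|p\|_\infty:=\max_{z\in\operatorname{supp}\mu}|p(z)|$. $\mathcal{P}_n(K)$ denotes the set of polynomials with complex coefficients of degree exactly $n$ all of whose zeros lie in $K$, and $$M_{n,q}(K,\mu):=\inf\left\{\frac{\|p'\|_q}{\|p\|_q}:\ p\in\mathcal{P}_n(K),\ \|p\|_q\ne0\right\}.$$ *)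

theory Defs
  imports "HOL-Analysis.Analysis" "HOL-Computational_Algebra.Polynomial"
begin

text \<open>
  The suprema and the infimum below are attained for nonempty compact \<open>K\<close>, so they are the
  maxima and the minimum of the usual definition. As for \<^const>\<open>diameter\<close>, the empty set gets
  the value 0.
\<close>

definition planar_width :: "complex set \<Rightarrow> real" where
  "planar_width K =
     (if K = {} then 0
      else INF \<gamma>\<in>{-pi..pi}. SUP (z, z')\<in>K \<times> K. Re (z * cis \<gamma>) - Re (z' * cis \<gamma>))"

definition msupport :: "'a::topological_space measure \<Rightarrow> 'a set" where
  "msupport \<mu> = {z \<in> space \<mu>. \<forall>U. open U \<and> z \<in> U \<longrightarrow> emeasure \<mu> (U \<inter> space \<mu>) > 0}"

text \<open>
  Meant for exponents \<open>0 < q \<le> \<infinity>\<close> and finite Borel measures on a compact set. There the integrand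
  is integrable and, unless \<open>\<mu>\<close> vanishes, the supremum is attained.
\<close>

definition Lq_norm :: "complex measure \<Rightarrow> ereal \<Rightarrow> complex poly \<Rightarrow> real" where
  "Lq_norm \<mu> q p =
     (if q = \<infinity> then SUP z\<in>msupport \<mu>. cmod (poly p z)
      else (\<integral>z. cmod (poly p z) powr real_of_ereal q \<partial>\<mu>) powr (1 / real_of_ereal q))"

definition polys_with_zeros_in :: "nat \<Rightarrow> complex set \<Rightarrow> complex poly set" where
  "polys_with_zeros_in n K = {p. degree p = n \<and> (\<forall>z. poly p z = 0 \<longrightarrow> z \<in> K)}"

text \<open>The infimum is taken in \<^typ>\<open>ereal\<close>, so that the infimum of the empty set is \<open>\<infinity>\<close>.\<close>

definition turan_M :: "nat \<Rightarrow> ereal \<Rightarrow> complex set \<Rightarrow> complex measure \<Rightarrow> ereal" where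
  "turan_M n q K \<mu> =
     Inf {ereal (Lq_norm \<mu> q (pderiv p) / Lq_norm \<mu> q p) | p.
            p \<in> polys_with_zeros_in n K \<and> Lq_norm \<mu> q p \<noteq> 0}"

definition C_star_fin :: "real \<Rightarrow> real" where
  "C_star_fin q =
     121 * ((5 * q + 4 + 2 * sqrt (4 * q\<^sup>2 + 10 * q + 4)) / (9 * q))
         * (4 * q + 5 + 2 * sqrt (4 * q\<^sup>2 + 10 * q + 4)) powr (1 / q)"

definition C_star :: "ereal \<Rightarrow> real" where
  "C_star q = (if q = \<infinity> then Lim at_top C_star_fin else C_star_fin (real_of_ereal q))"

end

theory Submission
  imports Defs "HOL-Real_Asymp.Real_Asymp"
begin

text \<open>
  Let \<open>e = w / d\<close> and \<open>M = 121 n e / d\<close>. If at every \<open>z \<in> K\<close> either \<open>\<bar>p'(z)\<bar> \<le> M \<bar>p(z)\<bar>\<close> or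
  \<open>\<bar>p'(z)\<bar> \<le> N \<bar>p(\<phi>(z))\<bar>\<close>, where \<open>\<phi>\<close> is a homothety of ratio \<open>t\<close> mapping the convex set \<open>K\<close> into
  itself, then integrating \<open>\<bar>p'\<bar>\<^sup>q\<close> and changing variables by \<open>\<phi>\<close> costs at most a factor
  \<open>(1 + 8)\<^bsup>1/q\<^esup>\<close> as soon as \<open>N\<^sup>q \<le> 8 t\<^sup>2 M\<^sup>q\<close>, and \<open>121 \<cdot> 9\<^bsup>1/q\<^esup>\<close> is at most the constant \<open>C\<^sub>q\<^sup>*\<close>.

  Let \<open>a\<close>, \<open>b\<close> span a diameter. For \<open>e \<ge> 1/30\<close> take \<open>p = (z - a)\<^sup>n\<close> and contract towards \<open>b\<close>. For
  \<open>e < 1/30\<close> distribute the zeros evenly over \<open>a\<close> and \<open>b\<close>, and contract towards the midpoint with ratio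
  \<open>t = e / 2\<close>. In the coordinate \<open>x\<close> with \<open>a\<close>, \<open>b\<close> at \<open>-1\<close>, \<open>1\<close>, the set \<open>K\<close> lies in
  \<open>\<bar>Im x\<bar> \<le> 4 e\<close>. The critical point near 0 gives the first alternative for \<open>\<bar>x\<bar> \<le> 12 e\<close>; farther out
  \<open>\<bar>x\<^sup>2 - 1\<bar>\<close> drops by a factor \<open>exp (- 23 e\<^sup>2)\<close>, and the lower bound on \<open>n\<close> makes the power of this
  factor small enough for the second alternative.
\<close>

section \<open>Homotheties of a convex set and the Lq norms on it\<close>

lemma homothety_in_convex:
  fixes K :: "complex set"
  assumes "convex K" "c \<in> K" "z \<in> K" "0 < t" "t \<le> 1"
  shows "c + t *\<^sub>R (z - c) \<in> K"
proof -
  have "c + t *\<^sub>R (z - c) = (1 - t) *\<^sub>R c + t *\<^sub>R z" by (simp add: algebra_simps)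
  thus ?thesis using assms by (simp add: convexD)
qed

text \<open>The substitution \<open>u = c + t *\<^sub>R (z - c)\<close> has Jacobian
  \<open>t\<^sup>2\<close> in the plane, so the left side is the integral of \<open>g\<close> over
  the image of \<open>K\<close>; this image lies in \<open>K\<close> by convexity, and
  \<open>g\<close> is nonnegative.\<close>

lemma integral_homothety_le:
  fixes K :: "complex set" and g :: "complex \<Rightarrow> real"
  assumes K: "compact K" "convex K" and c: "c \<in> K" and t: "0 < t" "t \<le> 1"
    and g: "continuous_on UNIV g" "\<And>z. 0 \<le> g z"
  shows "t\<^sup>2 * (\<integral>z. indicator K z * g (c + t *\<^sub>R (z - c)) \<partial>lborel) \<le> (\<integral>z. indicator K z * g z \<partial>lborel)"
proof -
  let ?T = "\<lambda>z::complex. (1 - t) *\<^sub>R c + t *\<^sub>R z"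
  have T: "?T z = c + t *\<^sub>R (z - c)" for z by (simp add: algebra_simps)
  let ?h = "\<lambda>z. indicator K z * g z"
  have int: "integrable lborel ?h"
    using borel_integrable_compact[OF K(1) continuous_on_subset[OF g(1)]] by simp
  have hm: "?h \<in> borel_measurable borel" using int by simp
  have aff: "lborel = density (distr lborel borel ?T) (\<lambda>_. ennreal (t\<^sup>2))"
    using lborel_affine[of t "(1 - t) *\<^sub>R c"] t by simp
  have Tm: "?T \<in> borel_measurable borel" by (intro borel_measurable_continuous_onI continuous_intros)
  have "integrable (density (distr lborel borel ?T) (\<lambda>_. ennreal (t\<^sup>2))) ?h"
    using int aff by simp
  hence "integrable (distr lborel borel ?T) (\<lambda>z. t\<^sup>2 *\<^sub>R ?h z)"
    by (subst (asm) integrable_density) (use hm in auto)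
  hence "integrable (distr lborel borel ?T) ?h" using t by simp
  hence intT: "integrable lborel (\<lambda>z. ?h (?T z))"
    by (subst (asm) integrable_distr_eq) (use hm Tm in auto)
  have "(\<integral>z. ?h z \<partial>lborel) = (\<integral>z. ?h z \<partial>density (distr lborel borel ?T) (\<lambda>_. ennreal (t\<^sup>2)))"
    using aff by simp
  also have "\<dots> = (\<integral>z. t\<^sup>2 *\<^sub>R ?h z \<partial>distr lborel borel ?T)"
    by (subst integral_density) (use hm in auto)
  also have "\<dots> = (\<integral>z. t\<^sup>2 *\<^sub>R ?h (?T z) \<partial>lborel)"
    by (subst integral_distr) (use hm Tm in auto)
  finally have eq: "(\<integral>z. ?h z \<partial>lborel) = t\<^sup>2 * (\<integral>z. ?h (?T z) \<partial>lborel)" by simp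
  have "continuous_on K (\<lambda>z. g (c + t *\<^sub>R (z - c)))"
    by (intro continuous_on_compose2[OF g(1)] continuous_intros) auto
  from borel_integrable_compact[OF K(1) this]
  \<comment> \<open>If \<open>z\<close> lies in \<open>K\<close>, so does \<open>?T z\<close>; hence
    \<open>indicator K z\<close> is at most \<open>indicator K (?T z)\<close>.\<close>
  have "(\<integral>z. indicator K z * g (c + t *\<^sub>R (z - c)) \<partial>lborel) \<le> (\<integral>z. ?h (?T z) \<partial>lborel)"
    using homothety_in_convex[OF K(2) c _ t] g(2)
    by (intro integral_mono intT) (auto simp: T indicator_def)
  thus ?thesis unfolding eq by (intro mult_left_mono) auto
qed

text \<open>A convex set with interior points lies in the closure of its interior, so each
  neighbourhood of a point of \<open>K\<close> meets \<open>K\<close> in a set containing a nonempty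
  open set. This turns the norm for infinite \<open>q\<close> into a supremum over
  \<open>K\<close>.\<close>

lemma msupport_restrict_lborel:
  fixes K :: "complex set"
  assumes "compact K" "convex K" "interior K \<noteq> {}"
  shows "msupport (restrict_space lborel K) = K"
proof -
  have Kb: "K \<in> sets borel" using assms(1) by (simp add: compact_imp_closed)
  have "emeasure (restrict_space lborel K) (U \<inter> K) > 0" if z: "z \<in> K" and U: "open U" "z \<in> U" for z U
  proof -
    have "z \<in> closure (interior K)"
      using convex_closure_interior[OF assms(2,3)] z closure_subset by blast
    then have ne: "U \<inter> interior K \<noteq> {}"
      using U by (meson disjoint_iff open_Int_closure_eq_empty)
    have "open (U \<inter> interior K)" using U by auto
    with ne have "emeasure lborel (U \<inter> interior K) > 0"
      by (metis borel_open gr_zeroI negligible_iff_null_sets null_setsI null_sets_completionI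
          open_not_negligible sets_lborel)
    also have "\<dots> \<le> emeasure lborel (U \<inter> K)"
      using U Kb interior_subset by (intro emeasure_mono) auto
    finally show ?thesis using Kb by (subst emeasure_restrict_space) auto
  qed
  thus ?thesis by (auto simp: msupport_def space_restrict_space)
qed

lemma ratio_bound_infinity:
  fixes K :: "complex set"
  assumes K: "compact K" "convex K" "interior K \<noteq> {}" and c: "c \<in> K" and t: "0 < t" "t \<le> 1"
    and MN: "0 \<le> M" "N \<le> M"
    and pw: "\<And>z. z \<in> K \<Longrightarrow> cmod (poly p' z) \<le> M * cmod (poly p z) \<or>
               cmod (poly p' z) \<le> N * cmod (poly p (c + t *\<^sub>R (z - c)))"
  shows "Lq_norm (restrict_space lborel K) \<infinity> p' \<le> M * Lq_norm (restrict_space lborel K) \<infinity> p"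
proof -
  let ?S = "SUP z\<in>K. cmod (poly p z)"
  have bdd: "bdd_above ((\<lambda>z. cmod (poly p z)) ` K)"
    by (intro bounded_imp_bdd_above compact_imp_bounded compact_continuous_image K continuous_intros)
  have S: "cmod (poly p z) \<le> ?S" if "z \<in> K" for z
    by (rule cSUP_upper[OF that bdd])
  have "cmod (poly p' z) \<le> M * ?S" if z: "z \<in> K" for z
  proof -
    have "cmod (poly p' z) \<le> M * cmod (poly p z) \<or>
               cmod (poly p' z) \<le> M * cmod (poly p (c + t *\<^sub>R (z - c)))"
      using pw[OF z] MN(2) mult_right_mono[OF MN(2), of "cmod (poly p (c + t *\<^sub>R (z - c)))"] by auto
    thus ?thesis
      using S[OF z] S[OF homothety_in_convex[OF K(2) c z t]] MN(1)
      by (meson mult_left_mono order_trans)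
  qed
  hence "(SUP z\<in>K. cmod (poly p' z)) \<le> M * ?S"
    using c by (intro cSUP_least) auto
  thus ?thesis by (simp add: Lq_norm_def msupport_restrict_lborel[OF K])
qed

lemma ratio_bound_finite:
  fixes K :: "complex set" and q :: real
  assumes K: "compact K" "convex K" and c: "c \<in> K" and t: "0 < t" "t \<le> 1" and q: "0 < q"
    and MN: "0 \<le> M" "0 \<le> N" "N powr q \<le> 8 * t\<^sup>2 * M powr q"
    and pw: "\<And>z. z \<in> K \<Longrightarrow> cmod (poly p' z) \<le> M * cmod (poly p z) \<or>
               cmod (poly p' z) \<le> N * cmod (poly p (c + t *\<^sub>R (z - c)))"
  shows "Lq_norm (restrict_space lborel K) (ereal q) p' \<le>
           9 powr (1 / q) * M * Lq_norm (restrict_space lborel K) (ereal q) p"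
proof -
  have Kb: "K \<in> sets borel" using K(1) by (simp add: compact_imp_closed)
  define T where "T = (\<lambda>z. c + t *\<^sub>R (z - c))"
  define g where "g = (\<lambda>z. cmod (poly p z) powr q)"
  define g' where "g' = (\<lambda>z. cmod (poly p' z) powr q)"
  have cont: "continuous_on UNIV g" "continuous_on UNIV g'" "continuous_on UNIV (\<lambda>z. g (T z))"
    unfolding g_def g'_def T_def using q
    by (intro continuous_on_powr' continuous_intros; simp)+
  have int: "integrable lborel (\<lambda>z. indicator K z * f z)" if "continuous_on UNIV f" for f :: "complex \<Rightarrow> real"
    using borel_integrable_compact[OF K(1) continuous_on_subset[OF that]] by simp
  have le: "g' z \<le> M powr q * g z + N powr q * g (T z)" if z: "z \<in> K" for z
  proof -
    consider "cmod (poly p' z) \<le> M * cmod (poly p z)" | "cmod (poly p' z) \<le> N * cmod (poly p (T z))"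
      using pw[OF z] by (auto simp: T_def)
    thus ?thesis
    proof cases
      case 1
      from powr_mono2[OF _ _ this, of q] have "g' z \<le> M powr q * g z"
        using q MN by (simp add: g_def g'_def powr_mult)
      thus ?thesis by (simp add: g_def add_increasing2)
    next
      case 2
      from powr_mono2[OF _ _ this, of q] have "g' z \<le> N powr q * g (T z)"
        using q MN by (simp add: g_def g'_def powr_mult)
      thus ?thesis by (simp add: g_def add_increasing)
    qed
  qed
  define I where "I = (\<integral>z. indicator K z * g z \<partial>lborel)"
  define I' where "I' = (\<integral>z. indicator K z * g' z \<partial>lborel)"
  define J where "J = (\<integral>z. indicator K z * g (T z) \<partial>lborel)"
  have nn: "0 \<le> I" "0 \<le> I'" "0 \<le> J" 
    unfolding I_def I'_def J_def g_def g'_def by (auto intro!: integral_nonneg_AE)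
  have "I' \<le> (\<integral>z. M powr q * (indicator K z * g z) + N powr q * (indicator K z * g (T z)) \<partial>lborel)"
    unfolding I'_def using le
    by (intro integral_mono int cont Bochner_Integration.integrable_add integrable_mult_right)
       (auto simp: indicator_def)
  also have "\<dots> = M powr q * I + N powr q * J"
    unfolding I_def J_def by (subst Bochner_Integration.integral_add) (auto intro!: int cont)
  \<comment> \<open>The factor \<open>t\<^sup>2\<close> granted by the bound on
    \<open>N powr q\<close> is exactly what the change of variables consumes.\<close>
  also have "N powr q * J \<le> 8 * M powr q * (t\<^sup>2 * J)"
    using mult_right_mono[OF MN(3) nn(3)] by (simp add: mult_ac)
  also have "8 * M powr q * (t\<^sup>2 * J) \<le> 8 * M powr q * I"
    unfolding J_def I_def T_def
    by (intro mult_left_mono integral_homothety_le K c t cont) (auto simp: g_def)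
  finally have "I' \<le> 9 * M powr q * I" by (simp add: mult_ac)
  hence "I' powr (1/q) \<le> (9 * M powr q * I) powr (1/q)"
    using nn q by (intro powr_mono2) auto
  also have "\<dots> = 9 powr (1/q) * M * I powr (1/q)"
    using nn MN q by (simp add: powr_mult powr_powr)
  finally show ?thesis
    unfolding Lq_norm_def I_def I'_def g_def g'_def using Kb
    by (simp add: integral_restrict_space)
qed

text \<open>The zeros of \<open>p\<close> form a finite set, whereas the interior of
  \<open>K\<close> is infinite and \<open>K\<close> has positive area. Positivity makes
  \<open>p\<close> an admissible competitor in \<open>turan_M\<close>.\<close>

lemma Lq_norm_pos:
  fixes K :: "complex set" and q :: ereal
  assumes K: "compact K" "convex K" "interior K \<noteq> {}" and q: "0 < q" and p: "p \<noteq> 0"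
  shows "0 < Lq_norm (restrict_space lborel K) q p"
proof -
  have Kb: "K \<in> sets borel" using K(1) by (simp add: compact_imp_closed)
  have fin: "finite {z. poly p z = 0}" by (rule poly_roots_finite[OF p])
  show ?thesis
  proof (cases "q = \<infinity>")
    case True
    have "infinite (interior K)" using K(3) by (metis finite_imp_not_open open_interior)
    then obtain z where z: "z \<in> interior K" "poly p z \<noteq> 0"
      using fin by (metis (mono_tags) finite_subset mem_Collect_eq subsetI)
    hence zK: "z \<in> K" using interior_subset by auto
    have bdd: "bdd_above ((\<lambda>z. cmod (poly p z)) ` K)"
      by (intro bounded_imp_bdd_above compact_imp_bounded compact_continuous_image K continuous_intros)
    have "0 < cmod (poly p z)" using z by simp
    also have "\<dots> \<le> (SUP z\<in>K. cmod (poly p z))" by (rule cSUP_upper[OF zK bdd])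
    finally show ?thesis using True by (simp add: Lq_norm_def msupport_restrict_lborel[OF K])
  next
    case False
    then obtain r where r: "q = ereal r" "0 < r" using q by (cases q) auto
    let ?g = "\<lambda>z. indicator K z * cmod (poly p z) powr r"
    have "continuous_on K (\<lambda>z. cmod (poly p z) powr r)"
      using r by (intro continuous_on_powr' continuous_intros; simp)
    from borel_integrable_compact[OF K(1) this] have int: "integrable lborel ?g" by simp
    have "(\<integral>z. ?g z \<partial>lborel) \<noteq> 0"
    proof
      assume "(\<integral>z. ?g z \<partial>lborel) = 0"
      hence "AE z in lborel. ?g z = 0"
        by (subst (asm) integral_nonneg_eq_0_iff_AE[OF int]) auto
      moreover have "AE z in lborel. z \<notin> {z. poly p z = 0}"
        using fin by (intro AE_not_in finite_imp_null_set_lborel)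
      ultimately have "AE z in lborel. z \<notin> K"
        by eventually_elim (auto simp: indicator_def)
      hence "K \<in> null_sets lborel" using Kb by (subst (asm) AE_iff_null_sets[symmetric]) auto
      hence "negligible K" by (simp add: negligible_iff_null_sets null_sets_completionI)
      hence "negligible (interior K)" using interior_subset negligible_subset by blast
      thus False using open_not_negligible K(3) by blast
    qed
    moreover have "0 \<le> (\<integral>z. ?g z \<partial>lborel)" by (intro integral_nonneg_AE) auto
    ultimately have "0 < (\<integral>z. ?g z \<partial>lborel)" by linarith
    thus ?thesis using r Kb by (simp add: Lq_norm_def integral_restrict_space)
  qed
qed

section \<open>The constant and its limit\<close>

lemma C_star_fin_tendsto: "(C_star_fin \<longlongrightarrow> 121) at_top"
  unfolding C_star_fin_def by real_asymp

lemma C_star_infinity: "C_star \<infinity> = 121"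
  using tendsto_Lim[OF _ C_star_fin_tendsto] by (simp add: C_star_def)

lemma C_star_lower:
  assumes "0 < q"
  shows "121 * 9 powr real_of_ereal (1 / q) \<le> C_star q"
proof (cases "q = \<infinity>")
  case True
  thus ?thesis by (simp add: C_star_infinity)
next
  case False
  then obtain r where r: "q = ereal r" "0 < r" using assms by (cases q) auto
  define s where "s = sqrt (4 * r\<^sup>2 + 10 * r + 4)"
  \<comment> \<open>The square of \<open>2 * r + 2\<close> is
    \<open>4 * r\<^sup>2 + 8 * r + 4\<close>. With this bound the fraction is at least 1, and the
    base of the power is at least \<open>8 * r + 9\<close>, hence at least 9.\<close>
  have s: "2 * r + 2 \<le> s"
    unfolding s_def using r by (intro real_le_rsqrt) (auto simp: power2_eq_square algebra_simps)
  have "1 \<le> (5 * r + 4 + 2 * s) / (9 * r)" using s r by (simp add: field_simps)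
  moreover have "9 powr (1 / r) \<le> (4 * r + 5 + 2 * s) powr (1 / r)"
    using s r by (intro powr_mono2) auto
  ultimately have "1 * 9 powr (1 / r) \<le> (5 * r + 4 + 2 * s) / (9 * r) * (4 * r + 5 + 2 * s) powr (1 / r)"
    by (intro mult_mono) auto
  from mult_left_mono[OF this, of 121]
  have "121 * 9 powr (1 / r) \<le> C_star_fin r"
    unfolding C_star_fin_def s_def[symmetric] by (simp only: mult.assoc mult_1_left zero_le_numeral simp_thms)
  thus ?thesis using r by (simp add: C_star_def one_ereal_def)
qed

section \<open>Width, diameter and interior\<close>

lemma planar_width_le:
  assumes "compact K" "K \<noteq> {}" "\<gamma> \<in> {-pi..pi}"
    and B: "\<And>z z'. z \<in> K \<Longrightarrow> z' \<in> K \<Longrightarrow> Re (z * cis \<gamma>) - Re (z' * cis \<gamma>) \<le> B"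
  shows "planar_width K \<le> B"
proof -
  let ?f = "\<lambda>\<gamma> (z, z'). Re (z * cis \<gamma>) - Re (z' * cis \<gamma>)"
  obtain x where x: "x \<in> K" using assms(2) by auto
  have bdd: "bdd_above (?f \<gamma> ` (K \<times> K))" for \<gamma>
    by (intro bounded_imp_bdd_above compact_imp_bounded compact_continuous_image compact_Times assms)
       (auto simp: case_prod_beta intro!: continuous_intros)
  \<comment> \<open>Pairs with equal entries give 0, which supplies the lower bound that
    \<open>cINF_lower\<close> requires of the family.\<close>
  have "0 \<le> (SUP zz\<in>K \<times> K. ?f \<gamma> zz)" for \<gamma>
    using cSUP_upper[OF _ bdd, of "(x, x)"] x by auto
  hence "planar_width K \<le> (SUP zz\<in>K \<times> K. ?f \<gamma> zz)"
    unfolding planar_width_def using assms(2,3) by (auto intro!: cINF_lower bdd_belowI[of _ 0])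
  also have "\<dots> \<le> B" using assms(2) B by (intro cSUP_least) auto
  finally show ?thesis .
qed

lemma planar_width_ge:
  assumes "compact K" "K \<noteq> {}"
    and B: "\<And>\<gamma>. \<exists>z\<in>K. \<exists>z'\<in>K. B \<le> Re (z * cis \<gamma>) - Re (z' * cis \<gamma>)"
  shows "B \<le> planar_width K"
proof -
  let ?f = "\<lambda>\<gamma> (z, z'). Re (z * cis \<gamma>) - Re (z' * cis \<gamma>)"
  have bdd: "bdd_above (?f \<gamma> ` (K \<times> K))" for \<gamma>
    by (intro bounded_imp_bdd_above compact_imp_bounded compact_continuous_image compact_Times assms)
       (auto simp: case_prod_beta intro!: continuous_intros)
  have "B \<le> (SUP zz\<in>K \<times> K. ?f \<gamma> zz)" for \<gamma>
  proof -
    obtain z z' where "z \<in> K" "z' \<in> K" "B \<le> ?f \<gamma> (z, z')" using B[of \<gamma>] by auto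
    thus ?thesis by (intro cSUP_upper2[OF bdd, of "(z, z')"]) auto
  qed
  thus ?thesis unfolding planar_width_def using assms(2) by (auto intro!: cINF_greatest)
qed

lemma planar_width_le_diameter:
  assumes "compact K" "K \<noteq> {}"
  shows "planar_width K \<le> diameter K"
proof (rule planar_width_le[OF assms, of 0])
  fix z z' assume "z \<in> K" "z' \<in> K"
  hence "dist z z' \<le> diameter K"
    using assms by (simp add: diameter_bounded_bound compact_imp_bounded)
  moreover have "Re (z - z') \<le> dist z z'" unfolding dist_norm by (rule complex_Re_le_cmod)
  ultimately show "Re (z * cis 0) - Re (z' * cis 0) \<le> diameter K" by simp
qed auto

text \<open>A convex set without interior lies on a line; rotating its normal \<open>a\<close> onto
  the real axis makes the real part constant on \<open>K\<close>, so the width would be 0.\<close>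

lemma interior_nonempty_if_width_pos:
  assumes "compact K" "convex K" "planar_width K > 0"
  shows "interior K \<noteq> {}"
proof
  assume "interior K = {}"
  then obtain a b where ab: "a \<noteq> 0" "K \<subseteq> {x. a \<bullet> x = b}"
    using empty_interior_subset_hyperplane[OF assms(2)] by metis
  have ne: "K \<noteq> {}" using assms(3) by (auto simp: planar_width_def)
  have "Re (z * cis (- Arg a)) = b / cmod a" if "z \<in> K" for z
  proof -
    have "cis (- Arg a) = cnj a / cmod a"
      using ab(1) by (simp add: cis_cnj[symmetric] cis_Arg sgn_div_norm scaleR_conv_of_real field_simps)
    hence "Re (z * cis (- Arg a)) = (a \<bullet> z) / cmod a"
      by (simp add: inner_complex_def field_simps)
    thus ?thesis using ab(2) that by auto
  qed
  hence "planar_width K \<le> 0"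
    using mpi_less_Arg[of a] Arg_le_pi[of a] by (intro planar_width_le[OF assms(1) ne, of "- Arg a"]) auto
  thus False using assms(3) by simp
qed

text \<open>The cross product of \<open>b - a\<close> and \<open>z - a\<close> is invariant under
  rotation. In every direction one of these two vectors must therefore have extent at least the
  cross product divided by twice the diameter. When \<open>a\<close> and \<open>b\<close> span a
  diameter, this keeps \<open>K\<close> within distance \<open>2 * planar_width K\<close> of the
  line through them.\<close>

lemma cross_product_le_width:
  assumes K: "compact K" "a \<in> K" "b \<in> K" "z \<in> K"
  shows "\<bar>Im (cnj (b - a) * (z - a))\<bar> \<le> 2 * diameter K * planar_width K"
proof -
  define d where "d = diameter K"
  define P where "P = b - a"
  define Q where "Q = z - a"
  let ?c = "\<bar>Im (cnj P * Q)\<bar>"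
  have PQ: "cmod P \<le> d" "cmod Q \<le> d"
    using diameter_bounded_bound[OF compact_imp_bounded[OF K(1)]] K
    unfolding P_def Q_def d_def by (metis dist_norm)+
  show ?thesis
  proof (cases "d = 0")
    case True
    thus ?thesis using PQ unfolding d_def by (simp add: P_def)
  next
    case False
    hence d: "d > 0" using PQ(1) norm_ge_zero[of P] by linarith
    have "?c / (2 * d) \<le> planar_width K"
    proof (rule planar_width_ge)
      fix \<gamma>
      define v where "v = cis \<gamma>"
      define S where "S = max \<bar>Re (P * v)\<bar> \<bar>Re (Q * v)\<bar>"
      \<comment> \<open>Rotation invariance: multiplying both vectors by the unit number
        \<open>v\<close> leaves \<open>cnj P * Q\<close> unchanged.\<close>
      have "cnj v * v = 1" by (simp add: v_def cis_cnj cis_mult)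
      moreover have "cnj (P * v) * (Q * v) = cnj P * Q * (cnj v * v)" by (simp add: mult_ac)
      moreover have "Im (cnj A * B) = Re A * Im B - Im A * Re B" for A B by simp
      ultimately have "?c = \<bar>Re (P * v) * Im (Q * v) - Im (P * v) * Re (Q * v)\<bar>"
        by (metis mult.right_neutral)
      also have "\<dots> \<le> \<bar>Re (P * v)\<bar> * \<bar>Im (Q * v)\<bar> + \<bar>Im (P * v)\<bar> * \<bar>Re (Q * v)\<bar>"
        by (metis abs_mult abs_triangle_ineq4)
      also have "\<dots> \<le> S * d + d * S"
        using abs_Im_le_cmod[of "P * v"] abs_Im_le_cmod[of "Q * v"] PQ d
        by (intro add_mono mult_mono) (auto simp: S_def norm_mult v_def)
      finally have cS: "?c / (2 * d) \<le> S" using d by (simp add: field_simps)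
      \<comment> \<open>The point \<open>u\<close> is \<open>b\<close> or \<open>z\<close>,
        whichever attains the maximum \<open>S\<close>.\<close>
      obtain u where u: "u \<in> K" "S = \<bar>Re (u * v) - Re (a * v)\<bar>"
        using K(3,4) unfolding S_def P_def Q_def left_diff_distrib minus_complex.sel max_def by metis
      show "\<exists>z\<in>K. \<exists>z'\<in>K. ?c / (2 * d) \<le> Re (z * cis \<gamma>) - Re (z' * cis \<gamma>)"
      proof (cases "Re (a * v) \<le> Re (u * v)")
        case True
        hence "?c / (2 * d) \<le> Re (u * cis \<gamma>) - Re (a * cis \<gamma>)" using u(2) cS by (simp add: v_def)
        thus ?thesis using u(1) K(2) by blast
      next
        case False
        hence "?c / (2 * d) \<le> Re (a * cis \<gamma>) - Re (u * cis \<gamma>)" using u(2) cS by (simp add: v_def)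
        thus ?thesis using u(1) K(2) by blast
      qed
    qed (use K in auto)
    thus ?thesis using d unfolding P_def Q_def d_def by (simp add: field_simps)
  qed
qed

section \<open>Wide sets: all zeros at one end of a diameter\<close>

text \<open>The logarithmic derivative has modulus \<open>n / cmod (z - a)\<close>, which is small
  enough unless \<open>z\<close> is within \<open>d / 4\<close> of \<open>a\<close>. In that case
  the midpoint of \<open>z\<close> and \<open>b\<close> is at distance at least
  \<open>3/8 * d\<close> from \<open>a\<close>, so \<open>p\<close> is larger there.\<close>

lemma poly_power_at_point_bounds:
  fixes a b z :: complex and n :: nat and d e :: real
  assumes n: "n > 0" and d: "cmod (b - a) = d" "0 < d" and e: "1 / 30 \<le> e"
  defines "p \<equiv> [:-a, 1:] ^ n"
  shows "cmod (poly (pderiv p) z) \<le> 121 * n * e / d * cmod (poly p z) \<or>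
         cmod (poly (pderiv p) z) \<le> 121 * n * e / d * cmod (poly p (b + (1/2) *\<^sub>R (z - b)))"
proof -
  obtain m where m: "n = Suc m" using n by (cases n) auto
  let ?r = "cmod (z - a)"
  let ?y = "b + (1/2) *\<^sub>R (z - b)"
  have p': "cmod (poly (pderiv p) z) = n * ?r ^ m"
    unfolding p_def m pderiv_power_Suc
    by (simp add: pderiv_pCons norm_mult norm_power del: of_nat_Suc power_Suc)
  have p: "cmod (poly p x) = cmod (x - a) * cmod (x - a) ^ m" for x
  proof -
    have "poly p x = (x - a) * (x - a) ^ m" by (simp add: p_def m algebra_simps)
    thus ?thesis by (simp add: norm_mult norm_power)
  qed
  \<comment> \<open>Since \<open>121 / 30\<close> exceeds 4, both cases only have to lose a factor
    4.\<close>
  have C: "4 \<le> 121 * e" using e by simp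
  show ?thesis
  proof (cases "d / 4 \<le> ?r")
    case True
    have "4 * ?r \<le> 121 * e * ?r" using C by (intro mult_right_mono) auto
    hence "d \<le> 121 * e * ?r" using True by linarith
    hence "1 \<le> 121 * e / d * ?r" using d by (simp add: field_simps)
    hence "1 * (n * ?r ^ m) \<le> (121 * e / d * ?r) * (n * ?r ^ m)" by (intro mult_right_mono) auto
    thus ?thesis unfolding p' p by (simp add: mult_ac)
  next
    case False
    have "?y - a = (1/2) *\<^sub>R ((b - a) + (z - a))" by (simp add: scaleR_conv_of_real field_simps)
    hence y: "cmod (?y - a) = 1/2 * cmod ((b - a) + (z - a))" by (simp only: norm_scaleR)
    have "d - ?r \<le> cmod ((b - a) + (z - a))" using norm_diff_ineq[of "b - a" "z - a"] d by simp
    hence y1: "3/8 * d \<le> cmod (?y - a)" using False unfolding y by linarith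
    have "4 * cmod (?y - a) \<le> 121 * e * cmod (?y - a)" using C by (intro mult_right_mono) auto
    hence "d \<le> 121 * e * cmod (?y - a)" using y1 d by linarith
    hence "1 \<le> 121 * e / d * cmod (?y - a)" using d by (simp add: field_simps)
    moreover have "n * ?r ^ m \<le> n * cmod (?y - a) ^ m"
      using y1 False d by (intro mult_left_mono power_mono) auto
    ultimately have "1 * (n * ?r ^ m) \<le> (121 * e / d * cmod (?y - a)) * (n * cmod (?y - a) ^ m)"
      by (rule mult_mono) (use d e in auto)
    thus ?thesis unfolding p' p by (simp add: mult_ac)
  qed
qed

section \<open>Thin sets: zeros at -1 and 1 in normalized coordinates\<close>

lemma cmod_square_minus_one_far:
  assumes e: "0 < e" "e \<le> 1/30" and x: "\<bar>Re x\<bar> \<le> 1" "\<bar>Im x\<bar> \<le> 4 * e" "12 * e \<le> cmod x"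
  shows "cmod (x\<^sup>2 - 1) \<le> 1 - 24 * e\<^sup>2"
proof -
  define X where "X = (Re x)\<^sup>2"
  define Y where "Y = (Im x)\<^sup>2"
  have e2: "e\<^sup>2 \<le> 1/900" using power_mono[OF e(2), of 2] e(1) by (simp add: power2_eq_square)
  have X: "0 \<le> X" "X \<le> 1" using x(1) by (auto simp: X_def abs_square_le_1)
  have "Y \<le> (4 * e)\<^sup>2" unfolding Y_def using power_mono[OF x(2), of 2] by simp
  hence Y: "0 \<le> Y" "Y \<le> 16 * e\<^sup>2" by (auto simp: Y_def)
  have "(12 * e)\<^sup>2 \<le> (cmod x)\<^sup>2" using x(3) e(1) by (intro power_mono) auto
  hence XY: "144 * e\<^sup>2 \<le> X + Y" by (simp add: cmod_power2 X_def Y_def)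
  have "(cmod (x\<^sup>2 - 1))\<^sup>2 = X * X + 2 * (X * Y) + Y * Y - 2 * X + 2 * Y + 1"
    unfolding cmod_power2 X_def Y_def by (simp add: power2_eq_square algebra_simps)
  \<comment> \<open>As \<open>X\<close> and \<open>Y\<close> are at most 1, the quadratic terms
    become linear and leave \<open>1 - X + 5 * Y\<close>. Then \<open>X\<close> is at least
    \<open>144 * e\<^sup>2 - Y\<close>, and \<open>- 144 + 6 * 16 = - 48\<close>.\<close>
  also have "\<dots> \<le> X * 1 + 2 * (1 * Y) + Y * 1 - 2 * X + 2 * Y + 1"
    using X Y e2 by (intro add_mono diff_mono mult_mono) auto
  also have "\<dots> \<le> 1 - 48 * e\<^sup>2" using XY Y by simp
  also have "\<dots> \<le> (1 - 24 * e\<^sup>2)\<^sup>2" by (simp add: power2_diff)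
  finally show ?thesis by (rule power2_le_imp_le) (use e2 in simp)
qed

lemma two_le_width_condition:
  fixes e \<kappa> :: real
  assumes e: "0 < e" "e < 1/30" and \<kappa>: "0 \<le> \<kappa>"
  shows "2 \<le> 2 * (1 + \<kappa>) * ln (1 / e)"
proof -
  have "3 \<le> 1 / e" using e by (simp add: field_simps)
  hence "exp 1 \<le> 1 / e" using exp_le by linarith
  hence L: "1 \<le> ln (1 / e)" using e by (subst ln_ge_iff) auto
  have "2 * (1 + 0) * 1 \<le> 2 * (1 + \<kappa>) * ln (1 / e)" using \<kappa> L by (intro mult_mono) auto
  thus ?thesis by simp
qed

text \<open>Here \<open>f'\<close> is the derivative of \<open>f\<close>, and the factor 2
  anticipates the chain rule for the map sending a diameter to the segment from -1 to 1. The power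
  \<open>e powr (2 * \<kappa>)\<close> pays for the Jacobian of the contraction once it is raised to
  the exponent \<open>q = 1 / \<kappa>\<close>.\<close>

lemma two_point_bounds:
  fixes x :: complex and e \<kappa> :: real and k j n :: nat
  assumes e: "0 < e" "e < 1/30" and \<kappa>: "0 \<le> \<kappa>"
    and n: "2 * (1 + \<kappa>) * ln (1 / e) \<le> n * e\<^sup>2" "n = Suc k + Suc (k + j)" "j \<le> 1"
    and x: "cmod (x + 1) \<le> 2" "cmod (x - 1) \<le> 2" "\<bar>Im x\<bar> \<le> 4 * e"
  defines "f \<equiv> \<lambda>x::complex. (x + 1) ^ Suc k * (x - 1) ^ Suc (k + j)"
    and "f' \<equiv> (of_nat n * x + of_nat j) * ((x + 1) ^ k * (x - 1) ^ (k + j))"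
  shows "2 * cmod f' \<le> 121 * n * e * cmod (f x) \<or>
         2 * cmod f' \<le> 121 * n * e * e powr (2 * \<kappa>) * cmod (f ((e / 2) *\<^sub>R x))"
proof -
  define A where "A = (\<lambda>x. cmod (x\<^sup>2 - 1))"
  have fac: "A x = cmod (x + 1) * cmod (x - 1)" for x
  proof -
    have "x\<^sup>2 - 1 = (x + 1) * (x - 1)" by (simp add: power2_eq_square algebra_simps)
    thus ?thesis by (simp only: A_def norm_mult)
  qed
  have f: "cmod (f x) = A x * (A x ^ k * cmod (x - 1) ^ j)" for x
    by (simp add: f_def norm_mult norm_power power_add power_mult_distrib fac)
  have f': "cmod f' = cmod (of_nat n * x + of_nat j) * (A x ^ k * cmod (x - 1) ^ j)"
    by (simp add: f'_def norm_mult norm_power power_add power_mult_distrib fac)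
  have nj: "cmod (of_nat n * x + of_nat j) \<le> n * cmod x + 1"
    using norm_triangle_ineq[of "of_nat n * x" "of_nat j"] n(3) by (simp add: norm_mult)
  have e2: "e\<^sup>2 \<le> 1/900" using power_mono[of e "1/30" 2] e by (simp add: power2_eq_square)
  have n2: "2 \<le> n * e\<^sup>2" by (rule order_trans[OF two_le_width_condition[OF e \<kappa>] n(1)])
  hence ne: "1 \<le> n * e" using e mult_left_mono[of "e\<^sup>2" e n] by (simp add: power2_eq_square)
  have "n * e\<^sup>2 \<le> n * (1/900)" using e2 by (intro mult_left_mono) auto
  hence nbig: "1800 \<le> real n" using n2 by simp
  have "2 * x = (x + 1) + (x - 1)" by simp
  hence "2 * cmod x \<le> cmod (x + 1) + cmod (x - 1)"
    using norm_triangle_ineq[of "x + 1" "x - 1"] norm_mult[of 2 x] by simp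
  hence x2: "cmod x \<le> 2" using x by linarith
  have "\<bar>Re x + 1\<bar> \<le> 2" "\<bar>Re x - 1\<bar> \<le> 2"
    using abs_Re_le_cmod[of "x + 1"] abs_Re_le_cmod[of "x - 1"] x by auto
  hence Re: "\<bar>Re x\<bar> \<le> 1" by linarith
  show ?thesis
  proof (cases "cmod x \<le> 12 * e")
    case True
    have "(cmod x)\<^sup>2 \<le> (12 * e)\<^sup>2" using True by (intro power_mono) auto
    also have "\<dots> \<le> 16/100" using e2 by (simp add: power_mult_distrib)
    finally have A: "84/100 \<le> A x"
      using norm_triangle_ineq2[of 1 "x\<^sup>2"] by (simp add: A_def norm_minus_commute norm_power)
    define r where "r = n * e"
    have "n * cmod x \<le> 12 * r"
      using mult_left_mono[OF True, of n] by (simp add: r_def)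
    \<comment> \<open>As \<open>r\<close> is at least 1, the left side is at most
      \<open>26 * r\<close>, well below \<open>121 * r * (84/100)\<close>.\<close>
    hence "2 * cmod (of_nat n * x + of_nat j) \<le> 121 * r * (84/100)"
      using nj ne unfolding r_def[symmetric] by linarith
    hence "2 * cmod (of_nat n * x + of_nat j) \<le> 121 * n * e * (84/100)"
      by (simp add: r_def mult_ac)
    also have "\<dots> \<le> 121 * n * e * A x" using A e by (intro mult_left_mono) auto
    finally have "2 * cmod (of_nat n * x + of_nat j) * (A x ^ k * cmod (x - 1) ^ j) \<le>
        121 * n * e * A x * (A x ^ k * cmod (x - 1) ^ j)"
      by (intro mult_right_mono) (auto simp: A_def)
    thus ?thesis unfolding f f' by (simp add: mult_ac)
  next
    case False
    define y where "y = (e / 2) *\<^sub>R x"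
    have yx: "cmod y \<le> e" using x2 e by (simp add: y_def mult_left_le)
    have A1: "A x \<le> 1 - 24 * e\<^sup>2"
      unfolding A_def using cmod_square_minus_one_far[OF e(1) _ Re x(3)] e(2) False by simp
    have "(cmod y)\<^sup>2 \<le> e\<^sup>2" using yx by (intro power_mono) auto
    hence B1: "1 - e\<^sup>2 \<le> A y"
      using norm_triangle_ineq2[of 1 "y\<^sup>2"] by (simp add: A_def norm_minus_commute norm_power)
    \<comment> \<open>Splitting \<open>1 - 24 * e\<^sup>2\<close> this way separates the lower bound
      \<open>1 - e\<^sup>2\<close> for \<open>A y\<close> from the gain, which is then bounded by an
      exponential.\<close>
    have "(1 - 23 * e\<^sup>2) * (1 - e\<^sup>2) = 1 - 24 * e\<^sup>2 + 23 * (e\<^sup>2)\<^sup>2"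
      by (simp add: power2_eq_square algebra_simps)
    hence "A x \<le> (1 - 23 * e\<^sup>2) * (1 - e\<^sup>2)"
      using A1 zero_le_power2[of "e\<^sup>2"] by linarith
    also have "\<dots> \<le> exp (- 23 * e\<^sup>2) * A y"
      using B1 e2 exp_ge_add_one_self[of "- 23 * e\<^sup>2"] by (intro mult_mono) auto
    finally have "A x ^ k \<le> (exp (- 23 * e\<^sup>2) * A y) ^ k" by (intro power_mono) (auto simp: A_def)
    also have "\<dots> = exp (- 23 * e\<^sup>2 * k) * A y ^ k"
      by (simp add: power_mult_distrib exp_of_nat_mult[symmetric] mult_ac)
    also have "exp (- 23 * e\<^sup>2 * k) \<le> exp ((2 + 2 * \<kappa>) * ln e)"
    proof -
      \<comment> \<open>The exponent \<open>k\<close> is about \<open>n / 2\<close>, and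
        \<open>n\<close> is at least 1800, so the decay is at least
        \<open>exp (- n * e\<^sup>2)\<close>, to which the lower bound on \<open>n\<close>
        applies.\<close>
      have "real n \<le> 23 * k" using n(2,3) nbig by linarith
      hence "n * e\<^sup>2 \<le> (23 * k) * e\<^sup>2" by (intro mult_right_mono) auto
      moreover have "2 * (1 + \<kappa>) * ln (1 / e) = - ((2 + 2 * \<kappa>) * ln e)"
        using e by (simp add: ln_div algebra_simps)
      moreover have "- 23 * e\<^sup>2 * k = - ((23 * k) * e\<^sup>2)" by simp
      ultimately show ?thesis unfolding exp_le_cancel_iff using n(1) by linarith
    qed
    also have "exp ((2 + 2 * \<kappa>) * ln e) = e powr 2 * e powr (2 * \<kappa>)"
      using e by (simp add: powr_def distrib_right exp_add)
    also have "e powr 2 = e\<^sup>2" using e by simp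
    finally have Ak: "A x ^ k \<le> e\<^sup>2 * e powr (2 * \<kappa>) * A y ^ k"
      by (simp add: A_def mult_right_mono)
    have y1: "1/2 \<le> cmod (y - 1)"
      using norm_triangle_ineq2[of 1 y] yx e by (simp add: norm_minus_commute)
    have j: "cmod (x - 1) ^ j \<le> 4 * cmod (y - 1) ^ j"
      using n(3) x(2) y1 by (cases j) auto
    have "2 * cmod (of_nat n * x + of_nat j) \<le> 6 * n"
      using nj mult_left_mono[OF x2 of_nat_0_le_iff[of n]] nbig by linarith
    hence "2 * cmod f' \<le> 6 * n * ((e\<^sup>2 * e powr (2 * \<kappa>) * A y ^ k) * (4 * cmod (y - 1) ^ j))"
      unfolding f' mult.assoc[symmetric, of 2] using Ak j
      by (intro mult_mono) (auto simp: A_def)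
    \<comment> \<open>Of the gained \<open>e\<^sup>2\<close>, one factor \<open>e\<close> stays in
      the final bound; the other absorbs the constants, as \<open>24 * e\<close> is less than
      1.\<close>
    also have "\<dots> = (24 * e) * (n * e * e powr (2 * \<kappa>) * (A y ^ k * cmod (y - 1) ^ j))"
      by (simp add: power2_eq_square mult_ac)
    also have "\<dots> \<le> (121 * A y) * (n * e * e powr (2 * \<kappa>) * (A y ^ k * cmod (y - 1) ^ j))"
      using B1 e e2 by (intro mult_right_mono) (auto simp: A_def)
    also have "\<dots> = 121 * n * e * e powr (2 * \<kappa>) * cmod (f y)" unfolding f by (simp add: mult_ac)
    finally show ?thesis unfolding y_def by blast
  qed
qed

section \<open>From pointwise alternatives to the infimum\<close>

lemma turan_M_le:
  fixes K :: "complex set" and q :: ereal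
  assumes K: "compact K" "convex K" "interior K \<noteq> {}" and c: "c \<in> K" and t: "0 < t" "t \<le> 1"
    and q: "0 < q" and p: "p \<in> polys_with_zeros_in n K" "p \<noteq> 0"
    and MN: "0 \<le> M" "0 \<le> N" "N \<le> M" "\<And>r. q = ereal r \<Longrightarrow> N powr r \<le> 8 * t\<^sup>2 * M powr r"
    and pw: "\<And>z. z \<in> K \<Longrightarrow> cmod (poly (pderiv p) z) \<le> M * cmod (poly p z) \<or>
               cmod (poly (pderiv p) z) \<le> N * cmod (poly p (c + t *\<^sub>R (z - c)))"
  shows "turan_M n q K (restrict_space lborel K) \<le> ereal (9 powr real_of_ereal (1 / q) * M)"
proof -
  let ?L = "Lq_norm (restrict_space lborel K) q"
  have pos: "0 < ?L p" by (rule Lq_norm_pos[OF K q p(2)])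
  have "?L (pderiv p) \<le> 9 powr real_of_ereal (1 / q) * M * ?L p"
  proof (cases q)
    case (real r)
    thus ?thesis using ratio_bound_finite[OF K(1,2) c t _ MN(1,2) MN(4) pw, of r] q
      by (simp add: one_ereal_def)
  next
    \<comment> \<open>For infinite \<open>q\<close> the quotient \<open>1 / q\<close> is 0, so the
      power of 9 equals 1.\<close>
    case PInf
    thus ?thesis using ratio_bound_infinity[OF K c t MN(1,3) pw] by simp
  qed (use q in auto)
  hence "?L (pderiv p) / ?L p \<le> 9 powr real_of_ereal (1 / q) * M"
    using pos by (simp add: field_simps)
  moreover have "turan_M n q K (restrict_space lborel K) \<le> ereal (?L (pderiv p) / ?L p)"
    unfolding turan_M_def using p(1) pos by (intro Inf_lower) auto
  ultimately show ?thesis by (meson ereal_less_eq(3) order_trans)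
qed

section \<open>The two-point polynomial on a diameter\<close>

text \<open>The scaling by \<open>s\<close> makes the linear factors equal to \<open>x + 1\<close>
  and \<open>x - 1\<close> in the coordinate that sends \<open>a\<close>, \<open>b\<close> to -1, 1.
  Taking \<open>j\<close> as the parity of the degree covers even and odd degrees alike.\<close>

definition two_point_poly :: "complex \<Rightarrow> complex \<Rightarrow> nat \<Rightarrow> nat \<Rightarrow> complex poly" where
  "two_point_poly a b k j =
     (let s = 2 / (b - a) in [:- (s * a), s:] ^ Suc k * [:- (s * b), s:] ^ Suc (k + j))"

lemma two_point_poly_in_polys_with_zeros_in:
  assumes "a \<noteq> b" "a \<in> K" "b \<in> K"
  shows "two_point_poly a b k j \<in> polys_with_zeros_in (Suc k + Suc (k + j)) K"
    and "two_point_poly a b k j \<noteq> 0"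
proof -
  define s where "s = 2 / (b - a)"
  have s: "s \<noteq> 0" using assms by (simp add: s_def)
  have p: "two_point_poly a b k j = [:- (s * a), s:] ^ Suc k * [:- (s * b), s:] ^ Suc (k + j)"
    by (simp add: two_point_poly_def s_def Let_def)
  have nz: "[:- (s * a), s:] ^ Suc k \<noteq> 0" "[:- (s * b), s:] ^ Suc (k + j) \<noteq> 0"
    using s by (simp_all del: power_Suc)
  show "two_point_poly a b k j \<noteq> 0" unfolding p using nz by (simp del: power_Suc)
  have "degree (two_point_poly a b k j) = Suc k + Suc (k + j)"
    unfolding p degree_mult_eq[OF nz] using s by (simp add: degree_power_eq del: power_Suc)
  moreover have "z \<in> K" if "poly (two_point_poly a b k j) z = 0" for z
  proof -
    have "s * (z - a) = 0 \<or> s * (z - b) = 0"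
      using that unfolding p by (auto simp: algebra_simps simp del: power_Suc)
    thus ?thesis using s assms by auto
  qed
  ultimately show "two_point_poly a b k j \<in> polys_with_zeros_in (Suc k + Suc (k + j)) K"
    by (simp add: polys_with_zeros_in_def)
qed

lemma poly_two_point_poly:
  assumes "a \<noteq> b"
  defines "x \<equiv> \<lambda>z. (2 * z - a - b) / (b - a)"
  shows "poly (two_point_poly a b k j) z = (x z + 1) ^ Suc k * (x z - 1) ^ Suc (k + j)"
    and "poly (pderiv (two_point_poly a b k j)) z =
           2 / (b - a) * ((of_nat (Suc k + Suc (k + j)) * x z + of_nat j) * ((x z + 1) ^ k * (x z - 1) ^ (k + j)))"
proof -
  define s where "s = 2 / (b - a)"
  define y where "y = x z"
  have p: "two_point_poly a b k j = [:- (s * a), s:] ^ Suc k * [:- (s * b), s:] ^ Suc (k + j)"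
    by (simp add: two_point_poly_def s_def Let_def)
  have ba: "b - a \<noteq> 0" using assms by simp
  have "s * (b - a) = 2"
    by (simp only: s_def times_divide_eq_left nonzero_mult_div_cancel_right[OF ba])
  hence sb: "s * b = s * a + 2" by (simp add: algebra_simps)
  have "y = (2 * z - a - b) * (s / 2)" by (simp only: y_def x_def s_def divide_inverse) simp
  also have "\<dots> = s * z - (s * a + s * b) / 2" by (simp add: field_simps)
  also have "\<dots> = s * z - (s * a + 1)" unfolding sb by (simp add: field_simps)
  finally have y0: "y = s * z - (s * a + 1)" .
  have y: "z * s - s * a = y + 1" "z * s - s * b = y - 1"
    unfolding sb y0 by (simp_all add: algebra_simps)
  show "poly (two_point_poly a b k j) z = (x z + 1) ^ Suc k * (x z - 1) ^ Suc (k + j)"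
    unfolding p by (simp add: y flip: y_def del: power_Suc)
  have "poly (pderiv (two_point_poly a b k j)) z =
      (y + 1) ^ Suc k * (of_nat (Suc (k + j)) * (y - 1) ^ (k + j) * s) +
      (y - 1) ^ Suc (k + j) * (of_nat (Suc k) * (y + 1) ^ k * s)"
    unfolding p pderiv_mult pderiv_power_Suc
    by (simp add: y pderiv_pCons del: power_Suc of_nat_Suc)
  \<comment> \<open>The linear factor is \<open>(k + 1) * (y - 1) + (k + j + 1) * (y + 1)\<close>;
    its zero is the critical point near 0.\<close>
  also have "\<dots> = s * ((of_nat (Suc k + Suc (k + j)) * y + of_nat j) * ((y + 1) ^ k * (y - 1) ^ (k + j)))"
    by (simp add: algebra_simps)
  finally show "poly (pderiv (two_point_poly a b k j)) z =
      2 / (b - a) * ((of_nat (Suc k + Suc (k + j)) * x z + of_nat j) * ((x z + 1) ^ k * (x z - 1) ^ (k + j)))"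
    by (simp add: s_def y_def)
qed

text \<open>In the coordinate \<open>x\<close> the contraction towards the midpoint \<open>c\<close>
  becomes multiplication by \<open>e / 2\<close>, and differentiation contributes the factor
  \<open>2 / (b - a)\<close> of modulus \<open>2 / d\<close>; the normalized estimate then
  applies.\<close>

lemma two_point_poly_bounds:
  fixes a b z :: complex and d e \<kappa> :: real and k j n :: nat
  assumes e: "0 < e" "e < 1/30" and \<kappa>: "0 \<le> \<kappa>"
    and n: "2 * (1 + \<kappa>) * ln (1 / e) \<le> n * e\<^sup>2" "n = Suc k + Suc (k + j)" "j \<le> 1"
    and d: "cmod (b - a) = d" "0 < d" "cmod (z - a) \<le> d" "cmod (z - b) \<le> d"
    and cross: "\<bar>Im (cnj (b - a) * (z - a))\<bar> \<le> 2 * d\<^sup>2 * e"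
  defines "p \<equiv> two_point_poly a b k j" and "c \<equiv> (a + b) / 2"
  shows "cmod (poly (pderiv p) z) \<le> 121 * n * e / d * cmod (poly p z) \<or>
         cmod (poly (pderiv p) z) \<le>
           121 * n * e / d * e powr (2 * \<kappa>) * cmod (poly p (c + (e / 2) *\<^sub>R (z - c)))"
proof -
  define x where "x = (\<lambda>z. (2 * z - a - b) / (b - a))"
  have ab: "a \<noteq> b" "b - a \<noteq> 0" using d by auto
  have x1: "x z + 1 = 2 * (z - a) / (b - a)" "x z - 1 = 2 * (z - b) / (b - a)"
    using ab by (simp_all add: x_def field_simps)
  have xb: "cmod (x z + 1) \<le> 2" "cmod (x z - 1) \<le> 2"
    unfolding x1 norm_mult norm_divide using d by (simp_all add: field_simps)
  \<comment> \<open>Taking imaginary parts turns the cross product bound into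
    \<open>\<bar>Im (x z)\<bar> \<le> 4 * e\<close>.\<close>
  have "cnj (b - a) * (z - a) = of_real (d\<^sup>2 / 2) * (x z + 1)"
  proof -
    define P where "P = b - a"
    have "complex_of_real (d\<^sup>2) = P * cnj P"
      using complex_norm_square[of P] d(1) by (simp add: P_def)
    moreover have "P \<noteq> 0" using ab by (simp add: P_def)
    ultimately show ?thesis unfolding x1 P_def[symmetric] of_real_divide by simp
  qed
  hence "Im (cnj (b - a) * (z - a)) = Im (of_real (d\<^sup>2 / 2) * (x z + 1))" by (rule arg_cong)
  also have "\<dots> = d\<^sup>2 / 2 * Im (x z)" by (simp del: of_real_divide of_real_power)
  finally have "\<bar>Im (cnj (b - a) * (z - a))\<bar> = d\<^sup>2 / 2 * \<bar>Im (x z)\<bar>" by (simp only: abs_mult) simp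
  hence "d\<^sup>2 * \<bar>Im (x z)\<bar> \<le> d\<^sup>2 * (4 * e)" using cross by simp
  hence Im: "\<bar>Im (x z)\<bar> \<le> 4 * e" using d(2) by simp
  have xc: "x (c + (e / 2) *\<^sub>R (z - c)) = (e / 2) *\<^sub>R x z"
    using ab by (simp add: x_def c_def scaleR_conv_of_real field_simps)
  have poly: "poly p z = (x z + 1) ^ Suc k * (x z - 1) ^ Suc (k + j)"
    "poly (pderiv p) z = 2 / (b - a) *
       ((of_nat n * x z + of_nat j) * ((x z + 1) ^ k * (x z - 1) ^ (k + j)))" for z
    unfolding p_def x_def n(2) by (rule poly_two_point_poly[OF ab(1)])+
  note bounds = two_point_bounds[OF e \<kappa> n xb Im]
  define F where "F = (\<lambda>z. cmod (poly p z))"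
  define F' where "F' = cmod ((of_nat n * x z + of_nat j) * ((x z + 1) ^ k * (x z - 1) ^ (k + j)))"
  have p': "cmod (poly (pderiv p) z) = 2 * F' / d"
    unfolding poly(2) F'_def norm_mult norm_divide d(1) by simp
  have "2 * F' \<le> 121 * n * e * F z \<or>
        2 * F' \<le> 121 * n * e * e powr (2 * \<kappa>) * F (c + (e / 2) *\<^sub>R (z - c))"
    using bounds unfolding F_def F'_def poly(1) xc by simp
  hence "2 * F' / d \<le> 121 * n * e * F z / d \<or>
        2 * F' / d \<le> 121 * n * e * e powr (2 * \<kappa>) * F (c + (e / 2) *\<^sub>R (z - c)) / d"
    using d(2) by (meson divide_right_mono less_imp_le)
  thus ?thesis unfolding p' F_def by simp
qed

section \<open>The bound for all widths\<close>

theorem corollary2: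
  fixes K :: "complex set" and w d :: real and q :: ereal and n :: nat
  assumes "compact K" and "convex K"
    and "w = planar_width K" and "w > 0" and "d = diameter K"
    and "0 < q"
    and "n > 0"
    and "real n \<ge> 2 * (1 + real_of_ereal (1 / q)) * (d\<^sup>2 / w\<^sup>2) * ln (d / w)"
  shows "turan_M n q K (restrict_space lborel K) \<le> ereal (C_star q * (w / d\<^sup>2) * real n)
         \<and> (C_star_fin \<longlongrightarrow> 121) at_top \<and> C_star \<infinity> = 121"
proof -
  note K = assms(1,2) and w = assms(3,4) and d = assms(5) and q = assms(6)
  define \<kappa> where "\<kappa> = real_of_ereal (1 / q)"
  define e where "e = w / d"
  define M where "M = 121 * n * e / d"
  have ne: "K \<noteq> {}" using w by (auto simp: planar_width_def)
  have int: "interior K \<noteq> {}" using interior_nonempty_if_width_pos[OF K] w by simp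
  have "w \<le> d" using planar_width_le_diameter[OF K(1) ne] w d by simp
  hence d0: "0 < d" using w by linarith
  have e0: "0 < e" using w d0 by (simp add: e_def)
  have M0: "0 \<le> M" using e0 d0 by (simp add: M_def)
  have \<kappa>0: "0 \<le> \<kappa>" using q unfolding \<kappa>_def by (cases q) (auto simp: one_ereal_def)
  obtain a b where ab: "a \<in> K" "b \<in> K" "dist b a = d"
    using diameter_compact_attained[OF K(1) ne] d by metis
  have abd: "cmod (b - a) = d" using ab by (simp add: dist_norm)
  have "turan_M n q K (restrict_space lborel K) \<le> ereal (9 powr \<kappa> * M)"
  proof (cases "1 / 30 \<le> e")
    case True
    show ?thesis unfolding \<kappa>_def
    \<comment> \<open>For \<open>t = 1/2\<close> the factor \<open>8 * t\<^sup>2\<close> is 2, which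
      allows \<open>N = M\<close>.\<close>
    proof (rule turan_M_le[OF K int ab(2) _ _ q, where t = "1/2" and N = M and p = "[:-a, 1:] ^ n"])
      show "[:-a, 1:] ^ n \<in> polys_with_zeros_in n K"
        using ab(1) by (auto simp: polys_with_zeros_in_def degree_power_eq)
      show "cmod (poly (pderiv ([:-a, 1:] ^ n)) z) \<le> M * cmod (poly ([:-a, 1:] ^ n) z) \<or>
          cmod (poly (pderiv ([:-a, 1:] ^ n)) z) \<le> M * cmod (poly ([:-a, 1:] ^ n) (b + (1/2) *\<^sub>R (z - b)))" for z
        unfolding M_def by (rule poly_power_at_point_bounds[OF assms(7) abd d0 True])
    qed (use M0 in \<open>auto simp: power2_eq_square\<close>)
  next
    case False
    hence e1: "e < 1/30" by simp
    \<comment> \<open>Multiplying by \<open>e\<^sup>2\<close> cancels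
      \<open>d\<^sup>2 / w\<^sup>2\<close> in the lower bound on \<open>n\<close>.\<close>
    have "real n * e\<^sup>2 \<ge> 2 * (1 + \<kappa>) * (d\<^sup>2 / w\<^sup>2) * ln (d / w) * e\<^sup>2"
      using assms(8) unfolding \<kappa>_def[symmetric] by (intro mult_right_mono) auto
    moreover have "2 * (1 + \<kappa>) * (d\<^sup>2 / w\<^sup>2) * ln (d / w) * e\<^sup>2 = 2 * (1 + \<kappa>) * ln (1 / e)"
      using w d0 by (simp add: e_def power_divide)
    ultimately have ne2: "2 * (1 + \<kappa>) * ln (1 / e) \<le> n * e\<^sup>2" by simp
    have "2 \<le> n * e\<^sup>2" by (rule order_trans[OF two_le_width_condition[OF e0 e1 \<kappa>0] ne2])
    also have "\<dots> \<le> real n * 1\<^sup>2" using e0 e1 by (intro mult_left_mono power_mono) auto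
    finally have "2 \<le> n" by simp
    \<comment> \<open>Since \<open>n\<close> is at least 2, the subtraction is exact, and
      \<open>n = 2 * k + 2 + j\<close>.\<close>
    define k j where "k = (n - 2) div 2" and "j = n mod 2"
    have nkj: "n = Suc k + Suc (k + j)" "j \<le> 1" using \<open>2 \<le> n\<close> unfolding k_def j_def by presburger+
    let ?p = "two_point_poly a b k j" and ?c = "(a + b) / 2" and ?N = "M * e powr (2 * \<kappa>)"
    have neq: "a \<noteq> b" using ab d0 by auto
    have c: "?c \<in> K" using convexD[OF K(2) ab(1,2), of "1/2" "1/2"] by (simp add: scaleR_conv_of_real field_simps)
    show ?thesis unfolding \<kappa>_def
    proof (rule turan_M_le[OF K int c _ _ q, where t = "e / 2" and N = ?N and p = ?p])
      show "?p \<in> polys_with_zeros_in n K" "?p \<noteq> 0"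
        using two_point_poly_in_polys_with_zeros_in[OF neq ab(1,2)] nkj by auto
      have "e powr (2 * \<kappa>) \<le> 1 powr (2 * \<kappa>)" using e0 e1 \<kappa>0 by (intro powr_mono2) auto
      thus "?N \<le> M" using M0 by (simp add: mult_left_le)
      show "?N powr r \<le> 8 * (e / 2)\<^sup>2 * M powr r" if r: "q = ereal r" for r
      proof -
        have r0: "0 < r" using q r by simp
        have "?N powr r = M powr r * e powr (2 * \<kappa> * r)" using M0 by (simp add: powr_mult powr_powr)
        \<comment> \<open>Hence \<open>?N powr r\<close> equals \<open>e\<^sup>2 * M powr r\<close>,
          while \<open>8 * (e / 2)\<^sup>2\<close> is \<open>2 * e\<^sup>2\<close>.\<close>
        also have "2 * \<kappa> * r = 2" using r r0 by (simp add: \<kappa>_def one_ereal_def)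
        also have "e powr 2 = e\<^sup>2" using e0 by simp
        finally show ?thesis by (simp add: power_divide mult.commute mult_right_mono)
      qed
      fix z assume z: "z \<in> K"
      have "cmod (z - a) \<le> d" "cmod (z - b) \<le> d"
        using diameter_bounded_bound[OF compact_imp_bounded[OF K(1)]] z ab d by (metis dist_norm)+
      moreover have "\<bar>Im (cnj (b - a) * (z - a))\<bar> \<le> 2 * d\<^sup>2 * e"
        using cross_product_le_width[OF K(1) ab(1,2) z] d w d0 by (simp add: e_def power2_eq_square)
      ultimately show "cmod (poly (pderiv ?p) z) \<le> M * cmod (poly ?p z) \<or>
          cmod (poly (pderiv ?p) z) \<le> ?N * cmod (poly ?p (?c + (e / 2) *\<^sub>R (z - ?c)))"
        unfolding M_def by (intro two_point_poly_bounds[OF e0 e1 \<kappa>0 ne2 nkj abd d0])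
    qed (use M0 e0 e1 in auto)
  qed
  also have "9 powr \<kappa> * M \<le> C_star q * (w / d\<^sup>2) * n"
  proof -
    have "9 powr \<kappa> * M = 121 * 9 powr \<kappa> * (w / d\<^sup>2 * n)"
      by (simp add: M_def e_def power2_eq_square)
    also have "\<dots> \<le> C_star q * (w / d\<^sup>2 * n)"
      unfolding \<kappa>_def using C_star_lower[OF q] w by (intro mult_right_mono) auto
    finally show ?thesis by (simp add: mult_ac)
  qed
  finally show ?thesis using C_star_fin_tendsto C_star_infinity by simp
qed

end
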